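(* Let $\{\eta_k\}_{k\ge 0}$ be (real or complex valued) random variables on a probability space, not necessarily independent, Gaussian or centered, and let $\{\sigma_k\}$ be a sequence of positive deterministic numbers. Suppose that $$\sum_{k=1}^\infty \mathbf{P}\left(\frac{|\eta_k|}{\sigma_k}>Q^k\right)<\infty\quad\text{for every } Q>1,$$ and $$\sum_{k=1}^\infty \mathbf{P}\left(\frac{|\eta_k|}{\sigma_k}<q^k\right)<\infty\quad\text{for every } q\in(0,1).$$ Then the radius of convergence $R$ of the random power series $h(z)=\sum_{k=0}^\infty \eta_k z^k$, $z\in\mathbb{C}$, is almost surely deterministic, and with probability one $$R=\frac{1}{\limsup_{n\to\infty}\sigma_n^{1/n}}.$$
   Context: Conventions: $1/0=\infty$ and $1/\infty=0$. *)

theory Defs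
  imports "HOL-Probability.Probability"
begin

end

theory Submission
  imports Defs
begin

text \<open>
  By the root test, the radius of convergence depends on the coefficients only through the growth
  of \<^term>\<open>\<lambda>n. root n (norm (\<eta> n \<omega>))\<close>, which does not feel factors that are neither
  exponentially large nor exponentially small. The two summability assumptions say just this about
  the ratios \<^term>\<open>\<lambda>n. norm (\<eta> n \<omega>) / \<sigma> n\<close>: for each fixed \<^term>\<open>Q\<close>, the first
  Borel-Cantelli lemma shows that almost surely the ratio is
  eventually at most \<^term>\<open>Q ^ n\<close>, and likewise from below. The exceptional null set depends on
  the base, so this is done for rational bases only, of which there are countably many. Since the
  rationals accumulate at 1 from both sides, the \<^term>\<open>n\<close>-th roots of the ratios tend to 1
  almost surely (\<open>root_tendsto_1_if_subexponential\<close>). A factor tending to 1 does not change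
  an upper limit, so the random coefficients have the same radius of convergence as the
  deterministic sequence (\<open>conv_radius_mult_subexponential\<close>).
\<close>

lemma (in prob_space) AE_eventually_not_if_summable:
  assumes "\<And>k. {\<omega> \<in> space M. P (Suc k) \<omega>} \<in> events"
    and "summable (\<lambda>k. prob {\<omega> \<in> space M. P (Suc k) \<omega>})"
  shows "AE \<omega> in M. eventually (\<lambda>n. \<not> P n \<omega>) sequentially"
proof -
  have "AE \<omega> in M. eventually (\<lambda>k. \<omega> \<in> space M - {\<omega> \<in> space M. P (Suc k) \<omega>}) sequentially"
    using assms by (intro borel_cantelli_AE1) (auto simp: emeasure_eq_measure)
  then show ?thesis
  proof (rule AE_mp, intro AE_I2 impI)
    fix \<omega>
    assume "eventually (\<lambda>k. \<omega> \<in> space M - {\<omega> \<in> space M. P (Suc k) \<omega>}) sequentially"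
    then have "eventually (\<lambda>k. \<not> P (Suc k) \<omega>) sequentially"
      by (rule eventually_mono) auto
    then show "eventually (\<lambda>n. \<not> P n \<omega>) sequentially"
      by (rule iffD1[OF eventually_sequentially_Suc])
  qed
qed

text \<open>
  Bounding the sequence by powers of bases arbitrarily close to 1 bounds its roots by the bases
  themselves. The bases are rational so that the lemma can be applied outside of a countable union
  of null sets.
\<close>

lemma root_tendsto_1_if_subexponential:
  fixes x :: "nat \<Rightarrow> real"
  assumes upper: "\<And>Q. Q \<in> \<rat> \<Longrightarrow> 1 < Q \<Longrightarrow> eventually (\<lambda>n. x n \<le> Q ^ n) sequentially"
    and lower: "\<And>q. q \<in> \<rat> \<Longrightarrow> 0 < q \<Longrightarrow> q < 1 \<Longrightarrow> eventually (\<lambda>n. q ^ n \<le> x n) sequentially"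
  shows "(\<lambda>n. root n (x n)) \<longlonglongrightarrow> 1"
proof (rule order_tendstoI)
  fix u :: real
  assume "1 < u"
  then obtain Q where Q: "Q \<in> \<rat>" "1 < Q" "Q < u"
    using Rats_dense_in_real by blast
  show "eventually (\<lambda>n. root n (x n) < u) sequentially"
    using upper[OF Q(1,2)] eventually_gt_at_top[of 0]
  proof eventually_elim
    case (elim n)
    then have "root n (x n) \<le> root n (Q ^ n)"
      by simp
    also have "\<dots> = Q"
      using elim Q by (simp add: real_root_power_cancel)
    finally show ?case
      using Q by simp
  qed
next
  fix l :: real
  assume "l < 1"
  then obtain q where q: "q \<in> \<rat>" "max 0 l < q" "q < 1"
    using Rats_dense_in_real[of "max 0 l" 1] by auto
  have "eventually (\<lambda>n. q ^ n \<le> x n) sequentially"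
    using q by (intro lower) auto
  then show "eventually (\<lambda>n. l < root n (x n)) sequentially"
    using eventually_gt_at_top[of 0]
  proof eventually_elim
    case (elim n)
    have "l < q"
      using q by simp
    also have "q = root n (q ^ n)"
      using elim q by (simp add: real_root_power_cancel)
    also have "\<dots> \<le> root n (x n)"
      using elim by simp
    finally show ?case .
  qed
qed

text \<open>
  This is the root test formula together with the fact that a factor with a positive finite limit
  can be pulled out of an upper limit, even an infinite one.
\<close>

lemma conv_radius_mult_subexponential:
  fixes a :: "nat \<Rightarrow> 'a :: banach" and s :: "nat \<Rightarrow> real"
  assumes "\<And>n. s n > 0"
    and ratio: "(\<lambda>n. root n (norm (a n) / s n)) \<longlonglongrightarrow> 1"
  shows "conv_radius a = 1 / limsup (\<lambda>n. ereal (root n (s n)))"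
proof -
  have "norm (a n) = norm (a n) / s n * s n" for n
    using assms(1)[of n] by simp
  then have "root n (norm (a n)) = root n (norm (a n) / s n) * root n (s n)" for n
    by (metis real_root_mult)
  then have "limsup (\<lambda>n. ereal (root n (norm (a n)))) =
      limsup (\<lambda>n. ereal (root n (norm (a n) / s n)) * ereal (root n (s n)))"
    by simp
  also have "\<dots> = 1 * limsup (\<lambda>n. ereal (root n (s n)))"
    using ratio by (intro ereal_limsup_lim_mult) (auto simp: one_ereal_def)
  finally show ?thesis
    by (simp add: conv_radius_def divide_ereal_def)
qed

theorem theorem3p2:
  fixes M :: "'a measure"
    and \<eta> :: "nat \<Rightarrow> 'a \<Rightarrow> complex"
    and \<sigma> :: "nat \<Rightarrow> real"
  assumes "prob_space M"
    and "\<And>k. \<eta> k \<in> borel_measurable M"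
    and "\<And>k. \<sigma> k > 0"
    and "\<And>Q::real. Q > 1 \<Longrightarrow>
      summable (\<lambda>k. measure M {\<omega> \<in> space M. norm (\<eta> (Suc k) \<omega>) / \<sigma> (Suc k) > Q ^ Suc k})"
    and "\<And>q::real. 0 < q \<Longrightarrow> q < 1 \<Longrightarrow>
      summable (\<lambda>k. measure M {\<omega> \<in> space M. norm (\<eta> (Suc k) \<omega>) / \<sigma> (Suc k) < q ^ Suc k})"
  shows "(\<exists>r::ereal. AE \<omega> in M. conv_radius (\<lambda>k. \<eta> k \<omega>) = r) \<and>
    (AE \<omega> in M. conv_radius (\<lambda>k. \<eta> k \<omega>) = 1 / limsup (\<lambda>n. ereal (root n (\<sigma> n))))"
proof -
  interpret prob_space M by fact
  note [measurable] = assms(2)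
  let ?x = "\<lambda>\<omega> n. norm (\<eta> n \<omega>) / \<sigma> n"
  have countable_bases: "countable (\<rat> \<inter> A)" for A :: "real set"
    using countable_rat by (rule countable_subset[rotated]) auto
  have "AE \<omega> in M. \<forall>Q\<in>\<rat> \<inter> {1<..}. eventually (\<lambda>n. \<not> ?x \<omega> n > Q ^ n) sequentially"
    using assms(4)
    by (subst AE_ball_countable[OF countable_bases])
       (auto intro!: AE_eventually_not_if_summable)
  moreover have "AE \<omega> in M. \<forall>q\<in>\<rat> \<inter> {0<..<1}. eventually (\<lambda>n. \<not> ?x \<omega> n < q ^ n) sequentially"
    using assms(5)
    by (subst AE_ball_countable[OF countable_bases])
       (auto intro!: AE_eventually_not_if_summable)
  ultimately have radius:
    "AE \<omega> in M. conv_radius (\<lambda>k. \<eta> k \<omega>) = 1 / limsup (\<lambda>n. ereal (root n (\<sigma> n)))"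
  proof eventually_elim
    case (elim \<omega>)
    then have "(\<lambda>n. root n (?x \<omega> n)) \<longlonglongrightarrow> 1"
      by (intro root_tendsto_1_if_subexponential) (auto simp: not_less)
    then show ?case
      using assms(3) by (rule conv_radius_mult_subexponential[rotated])
  qed
  then show ?thesis
    by blast
qed

end
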